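(* Let $X$ be a Tychonoff space, and let $z\in\upsilon X$. Then: (i) $\delta_z$ is bounded on each compact subset of $C_p(X)$; (ii) $z\in\kappa X$ if, and only if, the restriction of $\delta_z$ to each compact subset of $C_p(X)$ is continuous.
   Context: For a Tychonoff space $X$, $C_p(X)$ is the set $C(X)$ of all continuous real-valued functions on $X$ with the topology of pointwise convergence. $\beta X$ is the Stone–Čech compactification of $X$, and $\upsilon X$ is the (Hewitt) realcompactification of $X$, viewed as a subspace $X\subseteq\upsilon X\subseteq\beta X$ (the smallest realcompact subspace of $\beta X$ containing $X$). For $z\in\upsilon X$, $\delta_z:C(X)\to\mathbb{R}$ is the Dirac measure $\delta_z(f):=\bar f(z)$, where $\bar f$ is the unique continuous real-valued extension of $f$ to $\upsilon X$. A Tychonoff space is called a $\kappa$-space if it is homeomorphic to a closed subspace of $C_p(Y)$ for some locally compact (Hausdorff) space $Y$. The $\kappa$-completion $\kappa X$ of $X$ is the intersection of all subspaces of $\beta X$ that contain $X$ and are $\kappa$-spaces. *)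

theory Defs
  imports "HOL-Analysis.Analysis"
begin

text \<open>The library's \<^const>\<open>completely_regular_space\<close> does not include any separation axiom.\<close>

definition tychonoff_space :: "'a topology \<Rightarrow> bool" where
  "tychonoff_space X \<longleftrightarrow> completely_regular_space X \<and> Hausdorff_space X"

text \<open>Functions on a space are represented extensionally (\<^const>\<open>undefined\<close> off the carrier), so that
  equality in \<open>C(X)\<close> is equality of functions on \<open>X\<close>, and \<open>C(X)\<close> is a subset of the carrier of
  \<^term>\<open>powertop_real (topspace X)\<close>.\<close>

definition real_cfuns :: "'a topology \<Rightarrow> ('a \<Rightarrow> real) set" where
  "real_cfuns X = {f \<in> extensional (topspace X). continuous_map X euclideanreal f}"

definition Cp :: "'a topology \<Rightarrow> ('a \<Rightarrow> real) topology" where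
  "Cp X = subtopology (powertop_real (topspace X)) (real_cfuns X)"


section \<open>The Stone-Cech compactification\<close>

text \<open>\<open>\<beta>X\<close> is the closure of the image of \<open>X\<close> under the evaluation map into the cube indexed by all
  continuous functions from \<open>X\<close> to \<open>[0,1]\<close>. The inclusion of \<open>X\<close> in \<open>\<beta>X\<close> is the map \<open>beta_map X\<close>,
  so a subspace of \<open>\<beta>X\<close> contains \<open>X\<close> if it contains the image of this map.\<close>

definition unit_cfuns :: "'a topology \<Rightarrow> ('a \<Rightarrow> real) set" where
  "unit_cfuns X = {f \<in> extensional (topspace X). continuous_map X (top_of_set {0..1}) f}"

definition beta_map :: "'a topology \<Rightarrow> 'a \<Rightarrow> ('a \<Rightarrow> real) \<Rightarrow> real" where
  "beta_map X x = (\<lambda>f\<in>unit_cfuns X. f x)"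

definition unit_cube :: "'i set \<Rightarrow> ('i \<Rightarrow> real) topology" where
  "unit_cube I = product_topology (\<lambda>i. top_of_set {0..1}) I"

definition beta :: "'a topology \<Rightarrow> (('a \<Rightarrow> real) \<Rightarrow> real) topology" where
  "beta X = subtopology (unit_cube (unit_cfuns X))
     (unit_cube (unit_cfuns X) closure_of (beta_map X ` topspace X))"


section \<open>Realcompact spaces and the Hewitt realcompactification\<close>

text \<open>A space is realcompact if it is homeomorphic to a closed subspace of a power of the real line.
  The index set of the power is taken in a fixed type depending on the type of the points of \<open>Z\<close>;
  the lemma \<open>realcompact_spaceI\<close> below shows that index sets in arbitrary types give nothing more.\<close>

definition realcompact_space :: "'b topology \<Rightarrow> bool" where
  "realcompact_space Z \<longleftrightarrow> tychonoff_space Z \<and>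
     (\<exists>(I :: ('b \<Rightarrow> real) set) C. closedin (powertop_real I) C \<and>
        Z homeomorphic_space subtopology (powertop_real I) C)"

definition upsilon_set :: "'a topology \<Rightarrow> (('a \<Rightarrow> real) \<Rightarrow> real) set" where
  "upsilon_set X = \<Inter> {A. beta_map X ` topspace X \<subseteq> A \<and> A \<subseteq> topspace (beta X) \<and>
     realcompact_space (subtopology (beta X) A)}"

definition upsilon :: "'a topology \<Rightarrow> (('a \<Rightarrow> real) \<Rightarrow> real) topology" where
  "upsilon X = subtopology (beta X) (upsilon_set X)"

text \<open>Existence and uniqueness of the extension: lemma \<open>upsilon_extension_unique\<close> below.\<close>

definition upsilon_ext :: "'a topology \<Rightarrow> ('a \<Rightarrow> real) \<Rightarrow> ((('a \<Rightarrow> real) \<Rightarrow> real) \<Rightarrow> real)" where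
  "upsilon_ext X f = (THE g. g \<in> real_cfuns (upsilon X) \<and> (\<forall>x\<in>topspace X. g (beta_map X x) = f x))"

definition dirac :: "'a topology \<Rightarrow> (('a \<Rightarrow> real) \<Rightarrow> real) \<Rightarrow> ('a \<Rightarrow> real) \<Rightarrow> real" where
  "dirac X z f = upsilon_ext X f z"


section \<open>\<open>\<kappa>\<close>-spaces and the \<open>\<kappa>\<close>-completion\<close>

text \<open>The locally compact space \<open>Y\<close> is taken in a fixed type depending on the type of the points of
  \<open>Z\<close>; the lemma \<open>kappa_spaceI\<close> below shows that spaces \<open>Y\<close> of arbitrary type give nothing more.\<close>

definition kappa_space :: "'b topology \<Rightarrow> bool" where
  "kappa_space Z \<longleftrightarrow> tychonoff_space Z \<and>
     (\<exists>(Y :: (('b \<Rightarrow> real) set \<times> ('b \<Rightarrow> real)) topology) C.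
        locally_compact_space Y \<and> Hausdorff_space Y \<and>
        closedin (Cp Y) C \<and> Z homeomorphic_space subtopology (Cp Y) C)"

definition kappa_set :: "'a topology \<Rightarrow> (('a \<Rightarrow> real) \<Rightarrow> real) set" where
  "kappa_set X = \<Inter> {A. beta_map X ` topspace X \<subseteq> A \<and> A \<subseteq> topspace (beta X) \<and>
     kappa_space (subtopology (beta X) A)}"


section \<open>The definitions are independent of the chosen types\<close>

lemma Hausdorff_space_sum_topology:
  assumes "\<And>i. i \<in> I \<Longrightarrow> Hausdorff_space (X i)"
  shows "Hausdorff_space (sum_topology X I)"
  unfolding Hausdorff_space_def
proof (clarsimp simp: topspace_sum_topology)
  fix i a j b
  assume i: "i \<in> I" "a \<in> topspace (X i)" and j: "j \<in> I" "b \<in> topspace (X j)" and ne: "i = j \<longrightarrow> a \<noteq> b"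
  have op: "openin (sum_topology X I) (Pair k ` U)" if "k \<in> I" "openin (X k) U" for k U
    using open_map_component_injection[OF that(1)] that(2) by (auto simp: open_map_def)
  show "\<exists>U. openin (sum_topology X I) U \<and>
       (\<exists>V. openin (sum_topology X I) V \<and> (i, a) \<in> U \<and> (j, b) \<in> V \<and> disjnt U V)"
  proof (cases "i = j")
    case True
    then obtain U V where "openin (X i) U" "openin (X i) V" "a \<in> U" "b \<in> V" "disjnt U V"
      using assms[OF i(1)] i j ne unfolding Hausdorff_space_def by metis
    then show ?thesis using op[OF i(1)] True
      by (intro exI[of _ "Pair i ` U"] conjI exI[of _ "Pair i ` V"]) (auto simp: disjnt_iff)
  next
    case False
    show ?thesis using op[OF i(1) openin_topspace] op[OF j(1) openin_topspace] i j False
      by (intro exI[of _ "Pair i ` topspace (X i)"] conjI exI[of _ "Pair j ` topspace (X j)"])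
        (auto simp: disjnt_iff)
  qed
qed

lemma continuous_map_from_sum_topology:
  assumes "\<And>i. i \<in> I \<Longrightarrow> continuous_map (X i) Y (f \<circ> Pair i)"
  shows "continuous_map (sum_topology X I) Y f"
  unfolding continuous_map_def
proof (intro conjI allI impI)
  show "f \<in> topspace (sum_topology X I) \<rightarrow> topspace Y"
    using assms by (fastforce simp: continuous_map_def Pi_iff)
  fix U assume U: "openin Y U"
  have "{x. (i, x) \<in> {p \<in> topspace (sum_topology X I). f p \<in> U}} =
      {x \<in> topspace (X i). (f \<circ> Pair i) x \<in> U}" if "i \<in> I" for i
    using that by auto
  moreover have "openin (X i) {x \<in> topspace (X i). (f \<circ> Pair i) x \<in> U}" if "i \<in> I" for i
    using assms[OF that] U by (rule openin_continuous_map_preimage)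
  ultimately show "openin (sum_topology X I) {p \<in> topspace (sum_topology X I). f p \<in> U}"
    unfolding openin_sum_topology by auto
qed

lemma closed_embedding_lift:
  assumes \<Psi>: "continuous_map T S \<Psi>" and inj: "inj_on \<Psi> (topspace T)"
    and C: "closedin S C" and h: "homeomorphic_map Z (subtopology S C) h"
    and E: "continuous_map Z T E" and \<Psi>E: "\<forall>z\<in>topspace Z. \<Psi> (E z) = h z"
  shows "closedin T (E ` topspace Z) \<and> Z homeomorphic_space subtopology T (E ` topspace Z)"
proof -
  obtain k where k: "homeomorphic_maps Z (subtopology S C) h k"
    using h homeomorphic_map_maps by blast
  have ET: "E z \<in> topspace T" if "z \<in> topspace Z" for z
    using E that by (auto simp: continuous_map_def)
  have him: "h ` topspace Z = C"
    using homeomorphic_imp_surjective_map[OF h] closedin_subset[OF C] by (simp add: inf_absorb2)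
  have im: "E ` topspace Z = {F \<in> topspace T. \<Psi> F \<in> C}"
  proof (intro equalityI subsetI)
    fix F assume "F \<in> E ` topspace Z" then show "F \<in> {F \<in> topspace T. \<Psi> F \<in> C}"
      using ET \<Psi>E him by auto
  next
    fix F assume F: "F \<in> {F \<in> topspace T. \<Psi> F \<in> C}"
    then obtain z where z: "z \<in> topspace Z" "\<Psi> F = h z" using him by blast
    then have "\<Psi> F = \<Psi> (E z)" by (simp add: \<Psi>E)
    then have "F = E z" using inj F ET[OF z(1)] by (auto simp: inj_on_def)
    then show "F \<in> E ` topspace Z" using z by blast
  qed
  have cl: "closedin T (E ` topspace Z)"
    unfolding im using closedin_continuous_map_preimage[OF \<Psi> C] .
  have "homeomorphic_maps Z (subtopology T (E ` topspace Z)) E (k \<circ> \<Psi>)"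
    unfolding homeomorphic_maps_def
  proof (intro conjI ballI)
    show "continuous_map Z (subtopology T (E ` topspace Z)) E"
      using E by (auto simp: continuous_map_in_subtopology)
    have "continuous_map (subtopology T (E ` topspace Z)) (subtopology S C) \<Psi>"
      using \<Psi> im by (auto simp: continuous_map_in_subtopology continuous_map_from_subtopology)
    then show "continuous_map (subtopology T (E ` topspace Z)) Z (k \<circ> \<Psi>)"
      using k by (auto simp: homeomorphic_maps_def intro: continuous_map_compose)
    show "(k \<circ> \<Psi>) (E x) = x" if "x \<in> topspace Z" for x
      using that k by (simp add: \<Psi>E homeomorphic_maps_def)
    show "E ((k \<circ> \<Psi>) y) = y" if "y \<in> topspace (subtopology T (E ` topspace Z))" for y
      using that k by (auto simp: \<Psi>E homeomorphic_maps_def)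
  qed
  then show ?thesis using cl homeomorphic_space_def by blast
qed

lemma tychonoff_space_powertop: "tychonoff_space (powertop_real J)"
  unfolding tychonoff_space_def
  by (metis completely_regular_space_product_topology Hausdorff_space_product_topology
      Hausdorff_space_euclidean metrizable_imp_completely_regular_space metrizable_space_euclidean)

lemma tychonoff_space_subtopology:
  "tychonoff_space X \<Longrightarrow> tychonoff_space (subtopology X S)"
  by (simp add: tychonoff_space_def completely_regular_space_subtopology Hausdorff_space_subtopology)

lemma homeomorphic_tychonoff_space:
  "X homeomorphic_space Y \<Longrightarrow> tychonoff_space X \<longleftrightarrow> tychonoff_space Y"
  by (simp add: tychonoff_space_def homeomorphic_completely_regular_space homeomorphic_Hausdorff_space)

lemma continuous_map_powertop_component:
  "j \<in> J \<Longrightarrow> continuous_map (powertop_real J) euclideanreal (\<lambda>F. F j)"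
  using continuous_map_product_projection[of j J "\<lambda>_. euclideanreal"] by simp

lemma continuous_map_Cp_component:
  "y \<in> topspace Y \<Longrightarrow> continuous_map (Cp Y) euclideanreal (\<lambda>F. F y)"
  unfolding Cp_def
  by (intro continuous_map_from_subtopology continuous_map_powertop_component)

lemma topspace_Cp: "topspace (Cp Y) = real_cfuns Y"
  unfolding Cp_def real_cfuns_def by (auto simp: PiE_def)

lemma realcompact_spaceI:
  fixes Z :: "'b topology" and J :: "'c set"
  assumes C: "closedin (powertop_real J) C" and Z: "Z homeomorphic_space subtopology (powertop_real J) C"
  shows "realcompact_space Z"
proof -
  obtain h where h: "homeomorphic_map Z (subtopology (powertop_real J) C) h"
    using Z homeomorphic_space by blast
  have hc: "continuous_map Z (powertop_real J) h"
    using homeomorphic_imp_continuous_map[OF h] by (simp add: continuous_map_in_subtopology)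
  have hext: "h z \<in> extensional J" if "z \<in> topspace Z" for z
    using hc that by (auto simp: continuous_map_def PiE_def Pi_def)
  define r where "r = (\<lambda>j. \<lambda>z\<in>topspace Z. h z j)"
  define I where "I = r ` J"
  define E where "E = (\<lambda>z. \<lambda>g\<in>I. (g z :: real))"
  define \<Psi> where "\<Psi> = (\<lambda>F. \<lambda>j\<in>J. (F (r j) :: real))"
  have \<Psi>c: "continuous_map (powertop_real I) (powertop_real J) \<Psi>"
    unfolding continuous_map_componentwise
    by (auto simp: \<Psi>_def I_def intro: continuous_map_powertop_component)
  have inj: "inj_on \<Psi> (topspace (powertop_real I))"
  proof (rule inj_onI)
    fix F G assume F: "F \<in> topspace (powertop_real I)" and G: "G \<in> topspace (powertop_real I)"
      and eq: "\<Psi> F = \<Psi> G"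
    have "F (r j) = G (r j)" if "j \<in> J" for j
      using fun_cong[OF eq, of j] that by (simp add: \<Psi>_def)
    then show "F = G" using F G by (auto simp: I_def PiE_def intro: extensionalityI)
  qed
  have Ec: "continuous_map Z (powertop_real I) E"
    unfolding continuous_map_componentwise
  proof (intro conjI ballI)
    show "E ` topspace Z \<subseteq> extensional I" by (auto simp: E_def)
    fix g assume "g \<in> I"
    then obtain j where j: "j \<in> J" "g = r j" by (auto simp: I_def)
    have "continuous_map Z euclideanreal (\<lambda>z. h z j)"
      using hc j by (auto simp: continuous_map_componentwise)
    then have "continuous_map Z euclideanreal g"
      by (rule continuous_map_eq) (simp add: j r_def)
    then show "continuous_map Z euclideanreal (\<lambda>x. E x g)"
      using \<open>g \<in> I\<close> by (simp add: E_def)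
  qed
  have \<Psi>E: "\<Psi> (E z) = h z" if "z \<in> topspace Z" for z
    using hext[OF that] that by (auto simp: \<Psi>_def E_def I_def r_def intro: extensionalityI)
  have "tychonoff_space Z"
    using homeomorphic_tychonoff_space[OF Z] tychonoff_space_powertop tychonoff_space_subtopology by blast
  then show ?thesis
    unfolding realcompact_space_def using closed_embedding_lift[OF \<Psi>c inj C h Ec] \<Psi>E by blast
qed

lemma kappa_spaceI:
  fixes Z :: "'b topology" and Y :: "'c topology"
  assumes lc: "locally_compact_space Y" and "Hausdorff_space Y"
    and C: "closedin (Cp Y) C" and Z: "Z homeomorphic_space subtopology (Cp Y) C"
  shows "kappa_space Z"
proof -
  obtain h where h: "homeomorphic_map Z (subtopology (Cp Y) C) h"
    using Z homeomorphic_space by blast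
  have hc: "continuous_map Z (Cp Y) h"
    using homeomorphic_imp_continuous_map[OF h] by (simp add: continuous_map_in_subtopology)
  have hC: "h z \<in> real_cfuns Y" if "z \<in> topspace Z" for z
    using hc that by (auto simp: continuous_map_def topspace_Cp Pi_def)
  define P where "P = powertop_real (topspace Z)"
  define r where "r = (\<lambda>y. \<lambda>z\<in>topspace Z. h z y)"
  have rc: "continuous_map Y P r"
    unfolding P_def continuous_map_componentwise
  proof (intro conjI ballI)
    show "r ` topspace Y \<subseteq> extensional (topspace Z)" by (auto simp: r_def)
    fix z assume "z \<in> topspace Z"
    then show "continuous_map Y euclideanreal (\<lambda>x. r x z)"
      using hC by (simp add: r_def real_cfuns_def)
  qed
  define I where "I = {r ` K | K. compactin Y K}"
  define Y' where "Y' = sum_topology (\<lambda>L. subtopology P L) I"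
  have Icomp: "compactin P L" if "L \<in> I" for L
    using that rc by (auto simp: I_def intro: image_compactin)
  have HP: "Hausdorff_space P"
    unfolding P_def using tychonoff_space_powertop[unfolded tychonoff_space_def] by blast
  have lc': "locally_compact_space Y'"
    unfolding Y'_def locally_compact_space_sum_topology
    using Icomp by (simp add: compact_imp_locally_compact_space compact_space_subtopology)
  have H': "Hausdorff_space Y'"
    unfolding Y'_def by (intro Hausdorff_space_sum_topology Hausdorff_space_subtopology HP)
  have top': "topspace Y' = Sigma I (\<lambda>L. L)"
    using Icomp compactin_subset_topspace by (force simp: Y'_def)
  have single: "compactin Y {y}" if "y \<in> topspace Y" for y using that by simp
  have inY': "(r ` K, r y) \<in> topspace Y'" if "compactin Y K" "y \<in> K" for K y
    using that by (auto simp: top' I_def)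
  have inY1: "({r y}, r y) \<in> topspace Y'" if "y \<in> topspace Y" for y
    using inY'[OF single, of y] that by simp
  define D where "D = {F \<in> topspace (Cp Y'). \<forall>K y. compactin Y K \<and> y \<in> K \<longrightarrow>
     F (r ` K, r y) = F (r ` {y}, r y)}"
  have ysp: "y \<in> topspace Y" if "compactin Y K" "y \<in> K" for K y
    using that compactin_subset_topspace by blast
  have Dcl: "closedin (Cp Y') D"
  proof -
    have *: "closedin (Cp Y') {F \<in> topspace (Cp Y'). F (r ` K, r y) - F (r ` {y}, r y) \<in> {0}}"
      if "compactin Y K" "y \<in> K" for K y
      by (rule closedin_continuous_map_preimage[OF continuous_map_diff])
        (use that inY' inY1 ysp in \<open>auto intro!: continuous_map_Cp_component\<close>)
    have "D = topspace (Cp Y') \<inter> \<Inter> ((\<lambda>(K,y). {F \<in> topspace (Cp Y'). F (r ` K, r y) - F (r ` {y}, r y) \<in> {0}})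
       ` {(K,y). compactin Y K \<and> y \<in> K})"
      by (auto simp: D_def)
    also have "closedin (Cp Y') \<dots>"
      using * by (intro closedin_Inter[of "insert _ _", simplified]) auto
    finally show ?thesis .
  qed
  define T where "T = subtopology (Cp Y') D"
  have topT: "topspace T = D" using closedin_subset[OF Dcl] by (auto simp: T_def)
  define E where "E = (\<lambda>z. \<lambda>p\<in>topspace Y'. (snd p z :: real))"
  define \<Psi> where "\<Psi> = (\<lambda>F. \<lambda>y\<in>topspace Y. (F (r ` {y}, r y) :: real))"
  have \<Psi>D: "\<Psi> F \<in> real_cfuns Y" if F: "F \<in> D" for F
  proof -
    have Fc: "continuous_map Y' euclideanreal F"
      using F by (auto simp: D_def topspace_Cp real_cfuns_def)
    have "\<exists>U. openin Y U \<and> y \<in> U \<and> continuous_map (subtopology Y U) euclideanreal (\<Psi> F)"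
      if y: "y \<in> topspace Y" for y
    proof -
      obtain U K where U: "openin Y U" "compactin Y K" "y \<in> U" "U \<subseteq> K"
        using lc y by (auto simp: locally_compact_space_def)
      have KI: "r ` K \<in> I" using U by (auto simp: I_def)
      have "continuous_map (subtopology P (r ` K)) Y' (Pair (r ` K))"
        unfolding Y'_def using KI by (rule continuous_map_component_injection)
      moreover have "continuous_map (subtopology Y U) (subtopology P (r ` K)) r"
        using rc U by (auto simp: continuous_map_in_subtopology continuous_map_from_subtopology)
      ultimately have "continuous_map (subtopology Y U) euclideanreal (F \<circ> (Pair (r ` K) \<circ> r))"
        by (intro continuous_map_compose[OF _ Fc] continuous_map_compose)
      then have "continuous_map (subtopology Y U) euclideanreal (\<Psi> F)"
        by (rule continuous_map_eq) (use F U in \<open>auto simp: D_def \<Psi>_def\<close>)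
      then show ?thesis using U by blast
    qed
    then have "\<forall>y\<in>topspace Y. \<exists>U. openin Y U \<and> y \<in> U \<and> continuous_map (subtopology Y U) euclideanreal (\<Psi> F)"
      by blast
    then obtain U where U: "\<And>y. y \<in> topspace Y \<Longrightarrow> openin Y (U y) \<and> y \<in> U y \<and>
        continuous_map (subtopology Y (U y)) euclideanreal (\<Psi> F)"
      by metis
    have "continuous_map Y euclideanreal (\<Psi> F)"
      by (rule pasting_lemma[where I = "topspace Y" and T = U and f = "\<lambda>_. \<Psi> F"]) (use U in auto)
    then show ?thesis by (auto simp: real_cfuns_def \<Psi>_def)
  qed
  have \<Psi>c: "continuous_map T (Cp Y) \<Psi>"
    unfolding Cp_def[of Y] continuous_map_in_subtopology continuous_map_componentwise
  proof (intro conjI ballI)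
    show "\<Psi> ` topspace T \<subseteq> extensional (topspace Y)" by (auto simp: \<Psi>_def)
    show "\<Psi> \<in> topspace T \<rightarrow> real_cfuns Y" using \<Psi>D topT by auto
    fix y assume y: "y \<in> topspace Y"
    then have "continuous_map T euclideanreal (\<lambda>F. F (r ` {y}, r y))"
      unfolding T_def using inY1
      by (intro continuous_map_from_subtopology continuous_map_Cp_component) auto
    then show "continuous_map T euclideanreal (\<lambda>F. \<Psi> F y)" using y by (simp add: \<Psi>_def)
  qed
  have inj: "inj_on \<Psi> (topspace T)"
  proof (rule inj_onI)
    fix F G assume F: "F \<in> topspace T" and G: "G \<in> topspace T" and eq: "\<Psi> F = \<Psi> G"
    have "F p = G p" if p: "p \<in> topspace Y'" for p
    proof -
      obtain K y where K: "compactin Y K" "y \<in> K" "p = (r ` K, r y)"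
        using p by (auto simp: top' I_def)
      have "\<Psi> F y = \<Psi> G y" using eq by simp
      then show ?thesis using K F G ysp by (auto simp: topT D_def \<Psi>_def)
    qed
    then show "F = G" using F G
      by (auto simp: topT D_def topspace_Cp real_cfuns_def intro: extensionalityI)
  qed
  have Ec: "continuous_map Z (Cp Y') E"
    unfolding Cp_def[of Y'] continuous_map_in_subtopology continuous_map_componentwise
  proof (intro conjI ballI)
    show "E ` topspace Z \<subseteq> extensional (topspace Y')" by (auto simp: E_def)
    have "continuous_map Y' euclideanreal (E z)" if z: "z \<in> topspace Z" for z
    proof -
      have "continuous_map (subtopology P L) euclideanreal (\<lambda>g. g z)" for L
        unfolding P_def
        using z by (intro continuous_map_from_subtopology continuous_map_powertop_component)
      then have "continuous_map Y' euclideanreal (\<lambda>p. snd p z)"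
        unfolding Y'_def by (intro continuous_map_from_sum_topology) (simp add: o_def)
      then show ?thesis by (rule continuous_map_eq) (simp add: E_def)
    qed
    then show "E \<in> topspace Z \<rightarrow> real_cfuns Y'" by (auto simp: real_cfuns_def E_def)
    fix p assume p: "p \<in> topspace Y'"
    then obtain K y where K: "compactin Y K" "y \<in> K" "p = (r ` K, r y)"
      by (auto simp: top' I_def)
    have "continuous_map Z euclideanreal ((\<lambda>F. F y) \<circ> h)"
      using hc continuous_map_Cp_component[of y Y] ysp K by (intro continuous_map_compose) auto
    then show "continuous_map Z euclideanreal (\<lambda>x. E x p)"
      by (rule continuous_map_eq) (use K p in \<open>auto simp: E_def r_def\<close>)
  qed
  have ED: "E z \<in> D" if "z \<in> topspace Z" for z
  proof -
    have "E z \<in> topspace (Cp Y')" using Ec that by (auto simp: continuous_map_def)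
    then show ?thesis using inY' inY1 ysp by (auto simp: D_def E_def)
  qed
  have Ec': "continuous_map Z T E"
    unfolding T_def using Ec ED by (auto simp: continuous_map_in_subtopology)
  have \<Psi>E: "\<Psi> (E z) = h z" if z: "z \<in> topspace Z" for z
  proof (rule extensionalityI)
    show "\<Psi> (E z) \<in> extensional (topspace Y)" by (auto simp: \<Psi>_def)
    show "h z \<in> extensional (topspace Y)" using hC[OF z] by (auto simp: real_cfuns_def)
    fix y assume "y \<in> topspace Y"
    then show "\<Psi> (E z) y = h z y"
      using z inY'[OF single, of y] by (auto simp: \<Psi>_def E_def r_def)
  qed
  have cl: "closedin T (E ` topspace Z)" and hom: "Z homeomorphic_space subtopology T (E ` topspace Z)"
    using closed_embedding_lift[OF \<Psi>c inj C h Ec'] \<Psi>E by auto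
  have "closedin (Cp Y') (E ` topspace Z)"
    using cl Dcl closedin_closed_subtopology by (auto simp: T_def)
  moreover have "subtopology T (E ` topspace Z) = subtopology (Cp Y') (E ` topspace Z)"
    using ED unfolding T_def by (simp add: subtopology_subtopology inf_absorb2 image_subset_iff)
  moreover have "tychonoff_space Z"
    using homeomorphic_tychonoff_space[OF Z] tychonoff_space_powertop tychonoff_space_subtopology
    unfolding Cp_def by metis
  ultimately show ?thesis
    unfolding kappa_space_def using hom lc' H' by (metis (no_types, lifting))
qed


section \<open>\<open>\<beta>X\<close> is a compactification, and extensions to \<open>\<upsilon>X\<close> exist\<close>

lemma compact_Hausdorff_unit_cube: "compact_space (unit_cube I)" "Hausdorff_space (unit_cube I)"
  unfolding unit_cube_def
  by (auto simp: compact_space_product_topology Hausdorff_space_product_topology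
      compact_space_subtopology compactin_euclidean_iff Hausdorff_space_subtopology)

lemma compact_space_beta: "compact_space (beta X)"
  unfolding beta_def
  by (simp add: closedin_compact_space compact_Hausdorff_unit_cube compact_space_subtopology)

lemma Hausdorff_space_beta: "Hausdorff_space (beta X)"
  unfolding beta_def by (simp add: Hausdorff_space_subtopology compact_Hausdorff_unit_cube)

lemma tychonoff_space_beta: "tychonoff_space (beta X)"
  unfolding tychonoff_space_def
  by (meson Hausdorff_space_beta compact_Hausdorff_or_regular_imp_normal_space compact_space_beta
      normal_imp_completely_regular_space Hausdorff_imp_t1_space)

lemma continuous_beta_map_cube: "continuous_map X (unit_cube (unit_cfuns X)) (beta_map X)"
  unfolding unit_cube_def continuous_map_componentwise
  by (auto simp: beta_map_def unit_cfuns_def)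

lemma beta_map_subset_beta: "beta_map X ` topspace X \<subseteq> topspace (beta X)"
proof -
  have "beta_map X ` topspace X \<subseteq> topspace (unit_cube (unit_cfuns X))"
    by (rule continuous_map_image_subset_topspace[OF continuous_beta_map_cube])
  then show ?thesis
    unfolding beta_def by (simp add: closure_of_subset)
qed

lemma dense_beta_map: "beta X closure_of (beta_map X ` topspace X) = topspace (beta X)"
  using beta_map_subset_beta[of X] closure_of_subset_topspace[of "unit_cube (unit_cfuns X)"]
  unfolding beta_def by (auto simp: closure_of_subtopology inf_absorb2)

lemma embedding_beta_map:
  assumes "tychonoff_space X"
  shows "embedding_map X (beta X) (beta_map X)"
proof -
  have "mspace (submetric (cfunspace X euclidean_metric) {f. f \<in> topspace X \<rightarrow> {0..1}}) = unit_cfuns X"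
    (is "?L = _")
  proof -
    have "bounded (f ` topspace X)" if "f ` topspace X \<subseteq> {0..1}" for f :: "'a \<Rightarrow> real"
      using bounded_closed_interval that by (rule bounded_subset)
    then show ?thesis
      by (auto simp: unit_cfuns_def continuous_map_in_subtopology image_subset_iff Pi_iff)
  qed
  moreover have "completely_regular_space X" "Hausdorff_space X"
    using assms by (auto simp: tychonoff_space_def)
  ultimately have "embedding_map X (unit_cube (unit_cfuns X)) (beta_map X)"
    using completely_regular_space_cube_embedding_explicit[of X]
    by (simp only: unit_cube_def beta_map_def[abs_def])
  then show ?thesis
    using beta_map_subset_beta[of X] unfolding beta_def
    by (simp add: embedding_map_in_subtopology)
qed

lemma continuous_map_beta_component:
  assumes "u \<in> unit_cfuns X"
  shows "continuous_map (beta X) (top_of_set {0..1}) (\<lambda>p. p u)"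
  using assms unfolding beta_def unit_cube_def
  by (intro continuous_map_from_subtopology continuous_map_product_projection)

lemma beta_extension:
  assumes "continuous_map X (top_of_set {0..1::real}) f"
  shows "\<exists>g. continuous_map (beta X) (top_of_set {0..1}) g \<and> (\<forall>x\<in>topspace X. g (beta_map X x) = f x)"
proof (intro exI conjI)
  have u: "restrict f (topspace X) \<in> unit_cfuns X"
    using assms by (auto simp: unit_cfuns_def intro: continuous_map_eq)
  show "continuous_map (beta X) (top_of_set {0..1}) (\<lambda>p. p (restrict f (topspace X)))"
    using u by (rule continuous_map_beta_component)
  show "\<forall>x\<in>topspace X. beta_map X x (restrict f (topspace X)) = f x"
    using u by (simp add: beta_map_def)
qed

lemma realcompact_cozero_beta:
  assumes u: "u \<in> unit_cfuns X"
  shows "realcompact_space (subtopology (beta X) {p \<in> topspace (beta X). 0 < p u \<and> p u < 1})"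
    (is "realcompact_space (subtopology _ ?A)")
proof -
  define U where "U = unit_cfuns X"
  define J where "J = insert None (Some ` U)"
  define S where "S = prod_topology (powertop_real U) (prod_topology euclideanreal euclideanreal)"
  define Z where "Z = subtopology (beta X) ?A"
  have topZ: "topspace Z = ?A" by (auto simp: Z_def)
  have cube: "unit_cube U = subtopology (powertop_real U) (PiE U (\<lambda>_. {0..1}))"
    unfolding unit_cube_def by (simp add: subtopology_product_topology)
  have beta_sub: "beta X = subtopology (powertop_real U) (topspace (beta X))"
    and comp: "compactin (powertop_real U) (topspace (beta X))"
  proof -
    define B where "B = unit_cube U closure_of (beta_map X ` topspace X)"
    have eq: "beta X = subtopology (powertop_real U) (PiE U (\<lambda>_. {0..1}) \<inter> B)"
      unfolding beta_def B_def[symmetric] U_def[symmetric] cube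
      unfolding B_def U_def[symmetric] by (simp add: subtopology_subtopology cube)
    have "topspace (beta X) = PiE U (\<lambda>_. {0..1}) \<inter> B" unfolding eq by (auto simp: PiE_def)
    then show *: "beta X = subtopology (powertop_real U) (topspace (beta X))" using eq by simp
    have "topspace (beta X) \<subseteq> topspace (powertop_real U)" using eq by auto
    then show "compactin (powertop_real U) (topspace (beta X))"
      using compact_space_beta[of X] * by (metis compactin_subspace)
  qed
  define E :: "(('a \<Rightarrow> real) \<Rightarrow> real) \<Rightarrow> ('a \<Rightarrow> real) option \<Rightarrow> real" where
    "E = (\<lambda>p. \<lambda>j\<in>J. case j of None \<Rightarrow> 1 / (p u * (1 - p u)) | Some v \<Rightarrow> p v)"
  define \<Psi> where "\<Psi> = (\<lambda>F. \<lambda>v\<in>U. (F (Some v) :: real))"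
  have uU: "u \<in> U" using u by (simp add: U_def)
  have \<Psi>c: "continuous_map (powertop_real J) (powertop_real U) \<Psi>"
    unfolding continuous_map_componentwise
    by (auto simp: \<Psi>_def J_def intro: continuous_map_powertop_component)
  define C where "C = {F \<in> topspace (powertop_real J). \<Psi> F \<in> topspace (beta X)} \<inter>
     {F \<in> topspace (powertop_real J). F None * (F (Some u) * (1 - F (Some u))) \<in> {1}}"
  have closedC: "closedin (powertop_real J) C"
    unfolding C_def
  proof (intro closedin_Int)
    have "closedin (powertop_real U) (topspace (beta X))"
      using comp tychonoff_space_powertop[of U]
      by (auto simp: tychonoff_space_def intro: compactin_imp_closedin)
    then show "closedin (powertop_real J) {F \<in> topspace (powertop_real J). \<Psi> F \<in> topspace (beta X)}"
      using \<Psi>c closedin_continuous_map_preimage by blast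
    have "continuous_map (powertop_real J) euclideanreal (\<lambda>F. F None * (F (Some u) * (1 - F (Some u))))"
      by (intro continuous_intros continuous_map_powertop_component) (auto simp: J_def uU)
    then show "closedin (powertop_real J)
       {F \<in> topspace (powertop_real J). F None * (F (Some u) * (1 - F (Some u))) \<in> {1}}"
      by (rule closedin_continuous_map_preimage) simp
  qed
  have pU: "continuous_map (beta X) euclideanreal (\<lambda>p. p v)" and p01: "\<And>p. p \<in> topspace (beta X) \<Longrightarrow> 0 \<le> p v \<and> p v \<le> 1"
    if "v \<in> U" for v
    using continuous_map_beta_component[of v X] that
    by (auto simp: U_def continuous_map_in_subtopology Pi_iff)
  have pext: "p \<in> extensional U" if "p \<in> topspace (beta X)" for p
    using that compactin_subset_topspace[OF comp] by (auto simp: PiE_def)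
  have \<Psi>E: "\<Psi> (E p) = p" if "p \<in> topspace (beta X)" for p
    using pext[OF that] by (auto simp: \<Psi>_def E_def J_def intro: extensionalityI)
  have E\<Psi>: "E (\<Psi> F) = F" and \<Psi>A: "\<Psi> F \<in> ?A" if F: "F \<in> C" for F
  proof -
    have p: "\<Psi> F \<in> topspace (beta X)" and eq: "F None * (F (Some u) * (1 - F (Some u))) = 1"
      using F by (auto simp: C_def)
    have \<Psi>u: "\<Psi> F u = F (Some u)" using uU by (simp add: \<Psi>_def)
    have "F (Some u) \<noteq> 0" "F (Some u) \<noteq> 1" using eq by auto
    then show "\<Psi> F \<in> ?A" using p01[OF uU p] p \<Psi>u by auto
    show "E (\<Psi> F) = F"
    proof (rule extensionalityI[of _ J])
      show "E (\<Psi> F) \<in> extensional J" by (simp add: E_def)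
      show "F \<in> extensional J" using F by (auto simp: C_def PiE_def)
      fix j assume j: "j \<in> J"
      show "E (\<Psi> F) j = F j"
      proof (cases j)
        case None
        have "F None = 1 / (F (Some u) * (1 - F (Some u)))"
          using eq by (metis mult_eq_0_iff nonzero_eq_divide_eq zero_neq_one)
        then show ?thesis using None j \<Psi>u by (simp add: E_def)
      next
        case (Some v)
        then show ?thesis using j by (auto simp: E_def \<Psi>_def J_def)
      qed
    qed
  qed
  have Ec: "continuous_map Z (powertop_real J) E"
    unfolding continuous_map_componentwise
  proof (intro conjI ballI)
    show "E ` topspace Z \<subseteq> extensional J" by (auto simp: E_def)
    fix j assume j: "j \<in> J"
    show "continuous_map Z euclideanreal (\<lambda>x. E x j)"
    proof (cases j)
      case None
      have "continuous_map Z euclideanreal (\<lambda>p. 1 / (p u * (1 - p u)))"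
        by (intro continuous_map_real_divide continuous_intros)
          (use pU[OF uU] topZ in \<open>auto simp: Z_def intro: continuous_map_from_subtopology\<close>)
      then show ?thesis using None j by (simp add: E_def)
    next
      case (Some v)
      then show ?thesis using j pU[of v]
        by (auto simp: E_def Z_def J_def intro: continuous_map_from_subtopology)
    qed
  qed
  have EC: "E p \<in> C" if p: "p \<in> topspace Z" for p
  proof -
    have "E p \<in> topspace (powertop_real J)" using Ec p by (auto simp: continuous_map_def)
    then show ?thesis using p \<Psi>E[of p] uU unfolding topZ by (auto simp: C_def E_def J_def)
  qed
  have "homeomorphic_maps Z (subtopology (powertop_real J) C) E \<Psi>"
    unfolding homeomorphic_maps_def
  proof (intro conjI ballI)
    show "continuous_map Z (subtopology (powertop_real J) C) E"
      using Ec EC by (auto simp: continuous_map_in_subtopology)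
    have "Z = subtopology (powertop_real U) ?A"
      unfolding Z_def by (subst beta_sub) (simp add: subtopology_subtopology inf_absorb2 subset_iff)
    then show "continuous_map (subtopology (powertop_real J) C) Z \<Psi>"
      using \<Psi>c \<Psi>A by (auto simp: continuous_map_in_subtopology continuous_map_from_subtopology)
    show "\<Psi> (E x) = x" if "x \<in> topspace Z" for x using that \<Psi>E topZ by auto
    show "E (\<Psi> y) = y" if "y \<in> topspace (subtopology (powertop_real J) C)" for y
      using that E\<Psi> by auto
  qed
  then have "Z homeomorphic_space subtopology (powertop_real J) C"
    using homeomorphic_space_def by blast
  then show ?thesis using realcompact_spaceI[OF closedC] by (simp add: Z_def)
qed

lemma upsilon_extension_unique:
  assumes f: "f \<in> real_cfuns X"
  shows "\<exists>!g. g \<in> real_cfuns (upsilon X) \<and> (\<forall>x\<in>topspace X. g (beta_map X x) = f x)"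
proof -
  define u where "u = (\<lambda>x\<in>topspace X. 1/2 + arctan (f x) / pi)"
  have bd: "0 < 1/2 + arctan t / pi \<and> 1/2 + arctan t / pi < 1" for t
    using arctan_bounded[of t] by (auto simp: field_simps)
  have fc: "continuous_map X euclideanreal f" and fext: "f \<in> extensional (topspace X)"
    using f by (auto simp: real_cfuns_def)
  have "continuous_map X euclideanreal (\<lambda>x. 1/2 + arctan (f x) / pi)"
  proof -
    have "continuous_map euclideanreal euclideanreal (\<lambda>t::real. 1/2 + arctan t / pi)"
      by (auto intro!: continuous_intros)
    from continuous_map_compose[OF fc this] show ?thesis by (simp only: o_def)
  qed
  then have "continuous_map X euclideanreal u"
    by (rule continuous_map_eq) (simp add: u_def)
  then have u: "u \<in> unit_cfuns X"
    using bd by (auto simp: unit_cfuns_def u_def continuous_map_in_subtopology less_imp_le)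
  define A where "A = {p \<in> topspace (beta X). 0 < p u \<and> p u < 1}"
  have XA: "beta_map X ` topspace X \<subseteq> A"
    using beta_map_subset_beta[of X] bd u by (auto simp: A_def beta_map_def u_def)
  have UA: "upsilon_set X \<subseteq> A"
    using realcompact_cozero_beta[OF u] XA unfolding upsilon_set_def A_def by blast
  have Usub: "upsilon_set X \<subseteq> topspace (beta X)" using UA by (auto simp: A_def)
  then have topU: "topspace (upsilon X) = upsilon_set X" by (auto simp: upsilon_def)
  have XU: "beta_map X ` topspace X \<subseteq> upsilon_set X" by (auto simp: upsilon_set_def)
  define g where "g = (\<lambda>p\<in>upsilon_set X. tan (pi * (p u - 1/2)))"
  have "continuous_map (upsilon X) (top_of_set {0<..<1}) (\<lambda>p. p u)"
    using continuous_map_beta_component[OF u] UA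
    by (auto simp: upsilon_def A_def continuous_map_in_subtopology continuous_map_from_subtopology)
  moreover have "continuous_map (top_of_set {0<..<1}) euclideanreal (\<lambda>t. tan (pi * (t - 1/2)))"
  proof -
    have "cos (pi * (t - 1/2)) \<noteq> 0" if "0 < t" "t < 1" for t :: real
    proof -
      have "- (pi/2) < pi * (t - 1/2)" "pi * (t - 1/2) < pi/2"
        using that by (auto simp: algebra_simps)
      then show ?thesis using cos_gt_zero_pi[of "pi * (t - 1/2)"] by simp
    qed
    then show ?thesis by (auto intro!: continuous_intros)
  qed
  ultimately have "continuous_map (upsilon X) euclideanreal ((\<lambda>t. tan (pi * (t - 1/2))) \<circ> (\<lambda>p. p u))"
    by (rule continuous_map_compose)
  then have "continuous_map (upsilon X) euclideanreal g"
    by (rule continuous_map_eq) (simp add: g_def topU)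
  then have gC: "g \<in> real_cfuns (upsilon X)" by (simp add: real_cfuns_def g_def topU)
  have gf: "g (beta_map X x) = f x" if "x \<in> topspace X" for x
  proof -
    have "beta_map X x u = 1/2 + arctan (f x) / pi" using u that by (simp add: beta_map_def u_def)
    moreover have "beta_map X x \<in> upsilon_set X" using XU that by auto
    ultimately show ?thesis by (simp add: g_def tan_arctan)
  qed
  have dense: "upsilon X closure_of (beta_map X ` topspace X) = topspace (upsilon X)"
    unfolding upsilon_def using XU Usub dense_beta_map[of X]
    by (simp add: closure_of_subtopology inf_absorb2) (auto simp: closure_of_subtopology)
  have "g' = g" if g': "g' \<in> real_cfuns (upsilon X)" "\<forall>x\<in>topspace X. g' (beta_map X x) = f x" for g'
  proof (rule extensionalityI)
    show "g' \<in> extensional (topspace (upsilon X))" "g \<in> extensional (topspace (upsilon X))"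
      using g' gC by (auto simp: real_cfuns_def)
    fix p assume p: "p \<in> topspace (upsilon X)"
    show "g' p = g p"
      by (rule forall_in_closure_of_eq[of p "upsilon X" "beta_map X ` topspace X" euclideanreal])
        (use p dense g' gC gf in \<open>auto simp: real_cfuns_def\<close>)
  qed
  then show ?thesis using gC gf by blast
qed

end

theory Submission
  imports Defs
begin

text \<open>
  Everything is read off from one space, the set \<open>L\<close> (\<open>evaluation_limits X\<close>) of all pointwise limits,
  in \<open>\<real>\<^bsup>C(X)\<^esup>\<close>, of the evaluations at the points of \<open>X\<close>. By density of \<open>X\<close> in \<open>\<upsilon>X\<close>, each Dirac
  functional \<open>\<delta>\<^sub>z\<close> belongs to \<open>L\<close>; the coordinates of \<open>z\<close> in the cube containing \<open>\<beta>X\<close> are the values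
  of \<open>\<delta>\<^sub>z\<close> on the functions \<open>X \<rightarrow> [0,1]\<close>, and these values determine a member of \<open>L\<close>. The
  key lemma \<open>evaluation_limit_in_closed_subspace\<close> concerns a space \<open>X \<subseteq> A \<subseteq> \<beta>X\<close> embedded by \<open>h\<close> as a
  closed subspace \<open>C\<close> of a space \<open>T \<subseteq> \<real>\<^sup>J\<close>: for \<open>\<phi> \<in> L\<close>, apply \<open>\<phi>\<close> to the coordinates of \<open>h\<close>
  restricted to \<open>X\<close>. If the resulting point of \<open>\<real>\<^sup>J\<close> lies in \<open>T\<close>, then it is a limit in \<open>T\<close> of points of
  \<open>h(X)\<close>, so it lies in \<open>C\<close>, and the point of \<open>A\<close> corresponding to it has coordinates \<open>\<phi>(u)\<close>.

  The case \<open>T = \<real>\<^sup>J\<close> shows that every \<open>\<phi> \<in> L\<close> is some \<open>\<delta>\<^sub>z\<close> with \<open>z \<in> \<upsilon>X\<close>. In the case \<open>T = C\<^sub>p(Y)\<close> with \<open>Y\<close> locally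
  compact, each compact subset of \<open>Y\<close> is carried by the coordinates of \<open>h\<close> to a compact subset of \<open>C\<^sub>p(X)\<close>. So if \<open>\<delta>\<^sub>z\<close> is
  continuous on compact sets, then the point obtained from \<open>\<delta>\<^sub>z\<close> is a continuous function on \<open>Y\<close>; hence \<open>z\<close> lies in every
  \<open>\<kappa>\<close>-space between \<open>X\<close> and \<open>\<beta>X\<close> (lemma \<open>continuous_on_compacts_in_kappa_space\<close>). Conversely, the
  set of all \<open>z \<in> \<upsilon>X\<close> with \<open>\<delta>\<^sub>z\<close> continuous on compact sets contains \<open>X\<close> and is itself a \<open>\<kappa>\<close>-space
  (lemma \<open>kappa_space_continuous_on_compacts\<close>), since it embeds as a closed subspace of \<open>C\<^sub>p(Y)\<close>
  for the disjoint sum \<open>Y\<close> of all compact subspaces of \<open>C\<^sub>p(X)\<close>. This gives (ii).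

  For (i), given \<open>z \<in> \<upsilon>X\<close>, any sequence in \<open>C(X)\<close> takes the values prescribed by \<open>\<delta>\<^sub>z\<close> simultaneously at some
  point of \<open>X\<close> (lemma \<open>dirac_eq_evaluation_on_sequence\<close>). A sequence in a compact set on which \<open>\<delta>\<^sub>z\<close> is unbounded
  would therefore be unbounded at a point of \<open>X\<close>.
\<close>

section \<open>Extensions over the realcompactification\<close>

lemma continuous_map_beta_map:
  assumes "beta_map X ` topspace X \<subseteq> A"
  shows "continuous_map X (subtopology (beta X) A) (beta_map X)"
  using continuous_beta_map_cube[of X] assms beta_map_subset_beta[of X]
  by (auto simp: beta_def continuous_map_in_subtopology image_subset_iff)

lemma topspace_upsilon: "topspace (upsilon X) = upsilon_set X"
  and upsilon_set_subset_beta: "upsilon_set X \<subseteq> topspace (beta X)"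
  and beta_map_subset_upsilon: "beta_map X ` topspace X \<subseteq> upsilon_set X"
proof -
  show XU: "beta_map X ` topspace X \<subseteq> upsilon_set X"
    by (auto simp: upsilon_set_def)
  \<comment> \<open>An intersection of subsets of \<open>\<beta>X\<close> lies in \<open>\<beta>X\<close> only if there is at least one of them; a constant
    function with value in the open interval gives one, by the realcompactness of cozero sets.\<close>
  define u :: "'a \<Rightarrow> real" where "u = (\<lambda>x\<in>topspace X. 1/2)"
  define B where "B = {p \<in> topspace (beta X). 0 < p u \<and> p u < 1}"
  have u: "u \<in> unit_cfuns X"
    by (auto simp: u_def unit_cfuns_def continuous_map_in_subtopology
        intro: continuous_map_eq[of _ _ "\<lambda>_. 1/2"])
  have "beta_map X ` topspace X \<subseteq> B"
    using beta_map_subset_beta[of X] u by (auto simp: B_def beta_map_def u_def)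
  then have "upsilon_set X \<subseteq> B"
    unfolding upsilon_set_def using realcompact_cozero_beta[OF u]
    by (intro Inter_lower) (auto simp: B_def)
  then show "upsilon_set X \<subseteq> topspace (beta X)"
    by (auto simp: B_def)
  then show "topspace (upsilon X) = upsilon_set X"
    by (auto simp: upsilon_def)
qed

lemma dense_beta_map_upsilon:
  "upsilon X closure_of (beta_map X ` topspace X) = topspace (upsilon X)"
  unfolding upsilon_def
  using beta_map_subset_upsilon[of X] upsilon_set_subset_beta[of X] dense_beta_map[of X]
  by (simp add: closure_of_subtopology inf_absorb2) (auto simp: closure_of_subtopology)

lemma continuous_map_upsilon_eqI:
  assumes "continuous_map (upsilon X) euclideanreal g" "continuous_map (upsilon X) euclideanreal h"
    and "\<And>x. x \<in> topspace X \<Longrightarrow> g (beta_map X x) = h (beta_map X x)"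
    and "z \<in> topspace (upsilon X)"
  shows "g z = h z"
proof (rule forall_in_closure_of_eq[OF _ Hausdorff_space_euclidean assms(1,2)])
  show "z \<in> upsilon X closure_of (beta_map X ` topspace X)"
    using assms(4) by (simp add: dense_beta_map_upsilon)
qed (use assms(3) in blast)

lemma continuous_map_dirac:
  assumes "f \<in> real_cfuns X"
  shows "continuous_map (upsilon X) euclideanreal (\<lambda>z. dirac X z f)"
  using theI'[OF upsilon_extension_unique[OF assms]]
  by (simp add: dirac_def upsilon_ext_def real_cfuns_def)

lemma dirac_beta_map:
  assumes "f \<in> real_cfuns X" "x \<in> topspace X"
  shows "dirac X (beta_map X x) f = f x"
  using theI'[OF upsilon_extension_unique[OF assms(1)]] assms(2)
  by (simp add: dirac_def upsilon_ext_def)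

lemma unit_cfuns_subset_real_cfuns: "unit_cfuns X \<subseteq> real_cfuns X"
  by (auto simp: unit_cfuns_def real_cfuns_def continuous_map_in_subtopology)

lemma dirac_unit_cfuns:
  assumes "u \<in> unit_cfuns X" "z \<in> topspace (upsilon X)"
  shows "dirac X z u = z u"
proof (rule continuous_map_upsilon_eqI[OF continuous_map_dirac _ _ assms(2)])
  show "u \<in> real_cfuns X"
    using assms unit_cfuns_subset_real_cfuns by blast
  show "continuous_map (upsilon X) euclideanreal (\<lambda>p. p u)"
    using continuous_map_beta_component[OF assms(1)]
    by (auto simp: upsilon_def continuous_map_in_subtopology continuous_map_from_subtopology)
  show "dirac X (beta_map X x) u = beta_map X x u" if "x \<in> topspace X" for x
    using that assms(1) dirac_beta_map[of u X x] unit_cfuns_subset_real_cfuns[of X]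
    by (auto simp: beta_map_def)
qed

lemma restrict_dirac_unit_cfuns:
  assumes "z \<in> topspace (upsilon X)"
  shows "restrict (dirac X z) (unit_cfuns X) = z"
proof (rule extensionalityI)
  show "z \<in> extensional (unit_cfuns X)"
    using assms upsilon_set_subset_beta[of X]
    by (auto simp: topspace_upsilon beta_def unit_cube_def PiE_def)
qed (use assms in \<open>auto simp: dirac_unit_cfuns\<close>)

section \<open>Boundedness on compact sets\<close>

lemma continuous_map_suminf:
  fixes g :: "nat \<Rightarrow> 'b \<Rightarrow> real"
  assumes g: "\<And>n. continuous_map Z euclideanreal (g n)"
    and le: "\<And>n p. p \<in> topspace Z \<Longrightarrow> \<bar>g n p\<bar> \<le> M n" and M: "summable M"
  shows "continuous_map Z euclideanreal (\<lambda>p. \<Sum>n. g n p)"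
proof -
  have "uniform_limit (topspace Z) (\<lambda>n p. \<Sum>i<n. g i p) (\<lambda>p. \<Sum>n. g n p) sequentially"
    by (rule Weierstrass_m_test[OF _ M]) (use le in auto)
  then have "\<forall>\<^sub>F n in sequentially. \<forall>p\<in>topspace Z. dist (\<Sum>i<n. g i p) (\<Sum>n. g n p) < e" if "e > 0" for e
    using that by (simp add: uniform_limit_iff)
  moreover have "continuous_map Z euclideanreal (\<lambda>p. \<Sum>i<n. g i p)" for n
    by (intro continuous_intros g) auto
  ultimately show ?thesis
    using Met_TC.continuous_map_uniform_limit[where f = "\<lambda>n p. \<Sum>i<n. g i p" and X = Z
        and F = sequentially and g = "\<lambda>p. \<Sum>n. g n p"]
    by simp
qed

text \<open>A nonnegative continuous function on \<open>\<upsilon>X\<close> that vanishes at \<open>z\<close> must vanish at a point of \<open>X\<close>: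
  otherwise its reciprocal on \<open>X\<close> would extend to \<open>z\<close>. This is applied to a series that vanishes exactly
  where every function of the sequence has the same value as at \<open>z\<close>.\<close>

lemma dirac_eq_evaluation_on_sequence:
  fixes f :: "nat \<Rightarrow> 'a \<Rightarrow> real"
  assumes f: "\<And>n. f n \<in> real_cfuns X" and z: "z \<in> topspace (upsilon X)"
  obtains x where "x \<in> topspace X" "\<And>n. f n x = dirac X z (f n)"
proof -
  define t where "t n p = (1/2)^n * min 1 \<bar>dirac X p (f n) - dirac X z (f n)\<bar>" for n p
  define h where "h p = (\<Sum>n. t n p)" for p
  have t: "0 \<le> t n p" "t n p \<le> (1/2)^n" for n p
    by (auto simp: t_def mult_le_cancel_left1)
  have sum_geo: "summable (\<lambda>n. (1/2)^n :: real)"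
    by (simp add: summable_geometric)
  have sum_t: "summable (\<lambda>n. t n p)" for p
    by (rule summable_comparison_test[OF _ sum_geo]) (use t in auto)
  have t_cont: "continuous_map (upsilon X) euclideanreal (t n)" for n
    unfolding t_def[abs_def] by (intro continuous_intros continuous_map_dirac f) auto
  have h: "continuous_map (upsilon X) euclideanreal h"
    unfolding h_def[abs_def] by (rule continuous_map_suminf[OF t_cont _ sum_geo]) (use t in auto)
  have "\<exists>x\<in>topspace X. h (beta_map X x) = 0"
  proof (rule ccontr)
    assume nz: "\<not> (\<exists>x\<in>topspace X. h (beta_map X x) = 0)"
    have beta: "continuous_map X (upsilon X) (beta_map X)"
      unfolding upsilon_def by (rule continuous_map_beta_map[OF beta_map_subset_upsilon])
    define q where "q = (\<lambda>x\<in>topspace X. inverse (h (beta_map X x)))"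
    have "continuous_map X euclideanreal (\<lambda>x. inverse (h (beta_map X x)))"
      using nz continuous_map_compose[OF beta h] by (intro continuous_map_real_inverse) (auto simp: o_def)
    then have q: "q \<in> real_cfuns X"
      by (auto simp: real_cfuns_def q_def intro: continuous_map_eq)
    have "h z * dirac X z q = 1"
    proof (rule continuous_map_upsilon_eqI[OF _ _ _ z])
      show "continuous_map (upsilon X) euclideanreal (\<lambda>p. h p * dirac X p q)"
        by (intro continuous_intros h continuous_map_dirac q)
      show "h (beta_map X x) * dirac X (beta_map X x) q = 1" if "x \<in> topspace X" for x
        unfolding dirac_beta_map[OF q that] using nz that by (simp add: q_def)
    qed simp
    moreover have "h z = 0"
      by (simp add: h_def t_def)
    ultimately show False by simp
  qed
  then obtain x where x: "x \<in> topspace X" "h (beta_map X x) = 0" by blast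
  have "f n x = dirac X z (f n)" for n
  proof -
    have "t n (beta_map X x) = 0"
      using suminf_eq_zero_iff[OF sum_t t(1), of "beta_map X x"] x(2) by (simp add: h_def)
    then show ?thesis
      using x(1) f by (auto simp: t_def dirac_beta_map min_def split: if_splits)
  qed
  with x(1) that show thesis by blast
qed

lemma compactin_Cp_subset: "compactin (Cp X) K \<Longrightarrow> K \<subseteq> real_cfuns X"
  using compactin_subset_topspace topspace_Cp by metis

lemma bounded_dirac_image_compact:
  assumes z: "z \<in> topspace (upsilon X)" and K: "compactin (Cp X) K"
  shows "bounded (dirac X z ` K)"
proof (rule ccontr)
  assume "\<not> bounded (dirac X z ` K)"
  then have "\<exists>f\<in>K. \<bar>dirac X z f\<bar> > real n" for n
    unfolding bounded_iff by (metis image_iff not_le_imp_less real_norm_def)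
  then obtain f where f: "\<And>n. f n \<in> K" "\<And>n. \<bar>dirac X z (f n)\<bar> > real n" by metis
  then obtain x where x: "x \<in> topspace X" "\<And>n. f n x = dirac X z (f n)"
    using dirac_eq_evaluation_on_sequence[OF _ z, of f] compactin_Cp_subset[OF K] by (metis subsetD)
  have "compactin euclideanreal ((\<lambda>f. f x) ` K)"
    using image_compactin[OF K continuous_map_Cp_component[OF x(1)]] .
  then obtain B where "\<forall>f\<in>K. \<bar>f x\<bar> \<le> B"
    by (auto simp: bounded_iff dest!: compact_imp_bounded)
  then show False
    using f x(2) by (metis linorder_not_less order.trans real_arch_simple)
qed

section \<open>Pointwise limits of evaluations\<close>

text \<open>The evaluation functional at a point, as a point of the power of the reals indexed by \<open>C(X)\<close>; it is
  \<open>undefined\<close> outside \<open>C(X)\<close>.\<close>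

definition evaluation :: "'a topology \<Rightarrow> 'a \<Rightarrow> ('a \<Rightarrow> real) \<Rightarrow> real" where
  "evaluation X x = (\<lambda>f\<in>real_cfuns X. f x)"

text \<open>The functionals on \<open>C(X)\<close>, again \<open>undefined\<close> outside \<open>C(X)\<close>, that are pointwise limits of
  evaluations at points of \<open>X\<close>.\<close>

definition evaluation_limits :: "'a topology \<Rightarrow> (('a \<Rightarrow> real) \<Rightarrow> real) set" where
  "evaluation_limits X = powertop_real (real_cfuns X) closure_of (evaluation X ` topspace X)"

lemma evaluation_limit_eqI:
  assumes "\<phi> \<in> evaluation_limits X" and "Hausdorff_space T"
    and "continuous_map (powertop_real (real_cfuns X)) T F"
    and "continuous_map (powertop_real (real_cfuns X)) T G"
    and "\<And>x. x \<in> topspace X \<Longrightarrow> F (evaluation X x) = G (evaluation X x)"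
  shows "F \<phi> = G \<phi>"
  using assms(5)
  by (intro forall_in_closure_of_eq[OF assms(1)[unfolded evaluation_limits_def] assms(2-4)]) blast

lemma dirac_evaluation_limit:
  assumes z: "z \<in> topspace (upsilon X)"
  shows "restrict (dirac X z) (real_cfuns X) \<in> evaluation_limits X"
proof -
  let ?D = "\<lambda>z. restrict (dirac X z) (real_cfuns X)"
  have "continuous_map (upsilon X) (powertop_real (real_cfuns X)) ?D"
    by (auto simp: continuous_map_componentwise continuous_map_dirac)
  from continuous_map_image_closure_subset[OF this, of "beta_map X ` topspace X"]
  have "?D z \<in> powertop_real (real_cfuns X) closure_of (?D ` beta_map X ` topspace X)"
    using z dense_beta_map_upsilon[of X] by blast
  also have "?D ` beta_map X ` topspace X = evaluation X ` topspace X"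
    unfolding image_image
    unfolding evaluation_def by (intro image_cong refl restrict_ext) (rule dirac_beta_map)
  finally show ?thesis
    unfolding evaluation_limits_def .
qed

text \<open>Evaluations commute with the composition with a continuous function of one real variable, and hence so
  do their limits. Composing with an embedding of the line into \<open>[0,1]\<close> reduces arbitrary functions
  to functions into \<open>[0,1]\<close>.\<close>

lemma evaluation_limits_eqI:
  assumes \<phi>: "\<phi> \<in> evaluation_limits X" and \<psi>: "\<psi> \<in> evaluation_limits X"
    and eq: "\<And>u. u \<in> unit_cfuns X \<Longrightarrow> \<phi> u = \<psi> u"
  shows "\<phi> = \<psi>"
proof (rule extensionalityI)
  show "\<phi> \<in> extensional (real_cfuns X)" "\<psi> \<in> extensional (real_cfuns X)"
    using \<phi> \<psi> closure_of_subset_topspace[of "powertop_real (real_cfuns X)"]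
    unfolding evaluation_limits_def by (fastforce simp: PiE_def)+
next
  fix f assume f: "f \<in> real_cfuns X"
  define s :: "real \<Rightarrow> real" where "s r = 1/2 + arctan r / pi" for r
  have s01: "0 \<le> s r" "s r \<le> 1" for r
    using arctan_bounded[of r] by (auto simp: s_def field_simps)
  have s_cont: "continuous_map euclideanreal euclideanreal s"
    unfolding s_def[abs_def] by (auto intro!: continuous_intros)
  define u where "u = (\<lambda>x\<in>topspace X. s (f x))"
  have "continuous_map X euclideanreal (\<lambda>x. s (f x))"
    using continuous_map_compose[OF _ s_cont, of X f] f by (auto simp: real_cfuns_def o_def)
  then have u: "u \<in> unit_cfuns X"
    by (auto simp: unit_cfuns_def u_def continuous_map_in_subtopology s01 intro: continuous_map_eq)
  have "\<theta> u = s (\<theta> f)" if "\<theta> \<in> evaluation_limits X" for \<theta>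
  proof (rule evaluation_limit_eqI[OF that Hausdorff_space_euclidean])
    show "continuous_map (powertop_real (real_cfuns X)) euclidean (\<lambda>\<theta>. \<theta> u)"
      using u unit_cfuns_subset_real_cfuns by (intro continuous_map_powertop_component) blast
    show "continuous_map (powertop_real (real_cfuns X)) euclidean (\<lambda>\<theta>. s (\<theta> f))"
      using continuous_map_compose[OF continuous_map_powertop_component[OF f] s_cont] by (simp add: o_def)
    show "evaluation X x u = s (evaluation X x f)" if "x \<in> topspace X" for x
      using that f u unit_cfuns_subset_real_cfuns by (auto simp: evaluation_def u_def)
  qed
  then have "s (\<phi> f) = s (\<psi> f)"
    using \<phi> \<psi> eq[OF u] by metis
  then show "\<phi> f = \<psi> f"
    by (simp add: s_def arctan_eq_iff)
qed

text \<open>The argument compares two continuous maps into the power of the line indexed by \<open>unit_cfuns X\<close>: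
  the restriction of functionals to \<open>unit_cfuns X\<close>, and the composition of the inverse of \<open>h\<close> with the map that applies a functional to
  the coordinates of \<open>h\<close>. They agree on evaluations, hence at \<open>\<phi>\<close>. The second map is defined only on
  functionals sent into \<open>C\<close>, so the comparison takes place in the subspace \<open>W\<close> that consists of the
  evaluations and \<open>\<phi>\<close> alone.\<close>

lemma evaluation_limit_in_closed_subspace:
  fixes X :: "'a topology" and J :: "'j set"
  assumes \<phi>: "\<phi> \<in> evaluation_limits X"
    and XA: "beta_map X ` topspace X \<subseteq> A" and A: "A \<subseteq> topspace (beta X)"
    and C: "closedin (subtopology (powertop_real J) S) C"
    and h: "homeomorphic_map (subtopology (beta X) A) (subtopology (subtopology (powertop_real J) S) C) h"
    and S: "(\<lambda>j\<in>J. \<phi> (\<lambda>x\<in>topspace X. h (beta_map X x) j)) \<in> S"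
  shows "restrict \<phi> (unit_cfuns X) \<in> A"
proof -
  define P where "P = powertop_real (real_cfuns X)"
  define T where "T = subtopology (powertop_real J) S"
  define W where "W = subtopology P (insert \<phi> (evaluation X ` topspace X))"
  define r where "r j = (\<lambda>x\<in>topspace X. h (beta_map X x) j)" for j
  define G where "G \<psi> = (\<lambda>j\<in>J. \<psi> (r j))" for \<psi> :: "('a \<Rightarrow> real) \<Rightarrow> real"
  obtain k where k: "homeomorphic_maps (subtopology (beta X) A) (subtopology T C) h k"
    using h homeomorphic_map_maps T_def by blast
  have beta: "continuous_map X (subtopology (beta X) A) (beta_map X)"
    by (rule continuous_map_beta_map[OF XA])
  have hc: "continuous_map (subtopology (beta X) A) (subtopology T C) h"
    using k by (auto simp: homeomorphic_maps_def)
  have hb: "continuous_map X (subtopology T C) (h \<circ> beta_map X)"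
    using continuous_map_compose[OF beta hc] .
  then have hbJ: "continuous_map X (powertop_real J) (h \<circ> beta_map X)"
    by (auto simp: T_def continuous_map_in_subtopology)
  have r: "r j \<in> real_cfuns X" if "j \<in> J" for j
  proof -
    have "continuous_map X euclideanreal (\<lambda>x. h (beta_map X x) j)"
      using continuous_map_compose[OF hbJ continuous_map_powertop_component[OF that]] by (simp add: o_def)
    then show ?thesis
      by (auto simp: real_cfuns_def r_def intro: continuous_map_eq)
  qed
  have evP: "evaluation X x \<in> topspace P" for x
    by (auto simp: P_def evaluation_def)
  have \<phi>P: "\<phi> \<in> P closure_of (evaluation X ` topspace X)"
    using \<phi> by (simp add: evaluation_limits_def P_def)
  have topW: "topspace W = insert \<phi> (evaluation X ` topspace X)"
    using \<phi>P evP closure_of_subset_topspace by (fastforce simp: W_def)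
  have \<phi>W: "\<phi> \<in> W closure_of (evaluation X ` topspace X)"
    using \<phi>P by (auto simp: W_def closure_of_subtopology inf_absorb2 subset_insertI)
  have G_ev: "G (evaluation X x) = h (beta_map X x)" if x: "x \<in> topspace X" for x
  proof (rule extensionalityI)
    show "h (beta_map X x) \<in> extensional J"
      using hbJ x by (auto simp: continuous_map_componentwise)
    show "G (evaluation X x) \<in> extensional J" by (simp add: G_def)
    show "G (evaluation X x) j = h (beta_map X x) j" if "j \<in> J" for j
      using r[OF that] that x by (simp add: G_def evaluation_def) (simp add: r_def)
  qed
  have hbC: "h (beta_map X x) \<in> C" "h (beta_map X x) \<in> topspace T" if "x \<in> topspace X" for x
    using hb that by (auto simp: continuous_map_def)
  have "continuous_map P (powertop_real J) G"
    using r by (auto simp: continuous_map_componentwise G_def P_def intro: continuous_map_powertop_component)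
  moreover have "G \<phi> \<in> S" using S by (simp add: G_def r_def)
  ultimately have GT: "continuous_map W T G"
    using hbC topW by (auto simp: W_def T_def continuous_map_in_subtopology continuous_map_from_subtopology G_ev)
  have "G \<phi> \<in> T closure_of (G ` evaluation X ` topspace X)"
    using continuous_map_image_closure_subset[OF GT] \<phi>W by blast
  also have "\<dots> \<subseteq> C"
    using C hbC by (intro closure_of_minimal) (auto simp: T_def G_ev)
  finally have G\<phi>: "G \<phi> \<in> C" .
  have GC: "continuous_map W (subtopology T C) G"
    using GT G\<phi> hbC topW by (auto simp: continuous_map_in_subtopology G_ev)
  have kc: "continuous_map (subtopology T C) (subtopology (beta X) A) k"
    using k by (auto simp: homeomorphic_maps_def)
  define Q where "Q = powertop_real (unit_cfuns X)"
  have "continuous_map (beta X) Q id"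
    unfolding Q_def continuous_map_componentwise
  proof (intro conjI ballI)
    show "id ` topspace (beta X) \<subseteq> extensional (unit_cfuns X)"
      by (auto simp: beta_def unit_cube_def PiE_def)
  next
    fix u assume "u \<in> unit_cfuns X"
    then show "continuous_map (beta X) euclideanreal (\<lambda>p. id p u)"
      using continuous_map_beta_component[of u X] by (simp add: continuous_map_in_subtopology)
  qed
  then have "continuous_map (subtopology (beta X) A) Q id"
    by (rule continuous_map_from_subtopology)
  then have kG: "continuous_map W Q (id \<circ> (k \<circ> G))"
    by (intro continuous_map_compose[OF continuous_map_compose[OF GC kc]])
  have res: "continuous_map W Q (\<lambda>\<psi>. restrict \<psi> (unit_cfuns X))"
    using unit_cfuns_subset_real_cfuns[of X]
    by (auto simp: W_def Q_def P_def continuous_map_componentwise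
        intro!: continuous_map_from_subtopology continuous_map_powertop_component)
  have HQ: "Hausdorff_space Q"
    using tychonoff_space_powertop by (auto simp: Q_def tychonoff_space_def)
  have "restrict \<phi> (unit_cfuns X) = (id \<circ> (k \<circ> G)) \<phi>"
  proof (rule forall_in_closure_of_eq[OF \<phi>W HQ res kG])
    fix \<psi> assume "\<psi> \<in> evaluation X ` topspace X"
    then obtain x where x: "x \<in> topspace X" "\<psi> = evaluation X x" by blast
    have "k (h (beta_map X x)) = beta_map X x"
      using k beta x(1) by (auto simp: homeomorphic_maps_def continuous_map_def)
    then have "(id \<circ> (k \<circ> G)) \<psi> = beta_map X x"
      using x by (simp add: G_ev)
    also have "\<dots> = restrict \<psi> (unit_cfuns X)"
      unfolding beta_map_def x(2) evaluation_def
      using unit_cfuns_subset_real_cfuns[of X] by (intro restrict_ext) auto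
    finally show "restrict \<psi> (unit_cfuns X) = (id \<circ> (k \<circ> G)) \<psi>" by simp
  qed
  moreover have "k (G \<phi>) \<in> A"
    using kc GC topW by (auto simp: continuous_map_def)
  ultimately show ?thesis by simp
qed

text \<open>For a realcompact \<open>A\<close>, the ambient space in the preceding lemma is a full power of the line, so its
  last hypothesis is void.\<close>

lemma restrict_evaluation_limit_in_upsilon:
  assumes "\<phi> \<in> evaluation_limits X"
  shows "restrict \<phi> (unit_cfuns X) \<in> topspace (upsilon X)"
  unfolding topspace_upsilon upsilon_set_def
proof clarify
  fix A assume A: "beta_map X ` topspace X \<subseteq> A" "A \<subseteq> topspace (beta X)"
    and "realcompact_space (subtopology (beta X) A)"
  then obtain I :: "((('a \<Rightarrow> real) \<Rightarrow> real) \<Rightarrow> real) set" and C h where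
    C: "closedin (powertop_real I) C"
    "homeomorphic_map (subtopology (beta X) A) (subtopology (powertop_real I) C) h"
    unfolding realcompact_space_def homeomorphic_space by blast
  show "restrict \<phi> (unit_cfuns X) \<in> A"
    by (rule evaluation_limit_in_closed_subspace[OF assms A, of I UNIV C h]) (use C in auto)
qed

section \<open>Functionals continuous on compact sets\<close>

text \<open>The functional \<open>\<phi>\<close> has a continuous restriction to each compact subset of \<open>C\<^sub>p(X)\<close>.\<close>

definition continuous_on_compacts :: "'a topology \<Rightarrow> (('a \<Rightarrow> real) \<Rightarrow> real) \<Rightarrow> bool" where
  "continuous_on_compacts X \<phi> \<longleftrightarrow>
     (\<forall>K. compactin (Cp X) K \<longrightarrow> continuous_map (subtopology (Cp X) K) euclideanreal \<phi>)"

lemma continuous_map_if_continuous_on_compact_subspaces: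
  assumes "locally_compact_space Y"
    and cont: "\<And>K. compactin Y K \<Longrightarrow> continuous_map (subtopology Y K) Z F"
  shows "continuous_map Y Z F"
proof -
  have "\<forall>y\<in>topspace Y. \<exists>U. openin Y U \<and> y \<in> U \<and> continuous_map (subtopology Y U) Z F"
    using assms continuous_map_from_subtopology_mono unfolding locally_compact_space_def by metis
  then obtain U where U: "\<And>y. y \<in> topspace Y \<Longrightarrow> openin Y (U y) \<and> y \<in> U y \<and>
      continuous_map (subtopology Y (U y)) Z F"
    by metis
  show ?thesis
    by (rule pasting_lemma[where I = "topspace Y" and T = U and f = "\<lambda>_. F"]) (use U in auto)
qed

text \<open>With \<open>h\<close> an embedding of \<open>A\<close> as a closed subspace of \<open>C\<^sub>p(Y)\<close>, let \<open>r y\<close> be the function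
  \<open>x \<mapsto> h(x)(y)\<close> on \<open>X\<close>. The map \<open>r\<close> into \<open>C\<^sub>p(X)\<close> is continuous, so \<open>y \<mapsto> \<delta>\<^sub>z(r y)\<close> is
  continuous on compact subsets of \<open>Y\<close>, hence on \<open>Y\<close>.\<close>

lemma continuous_on_compacts_in_kappa_space:
  assumes z: "z \<in> topspace (upsilon X)" and cont: "continuous_on_compacts X (dirac X z)"
    and A: "beta_map X ` topspace X \<subseteq> A" "A \<subseteq> topspace (beta X)"
    and \<kappa>: "kappa_space (subtopology (beta X) A)"
  shows "z \<in> A"
proof -
  obtain Y :: "(((('a \<Rightarrow> real) \<Rightarrow> real) \<Rightarrow> real) set \<times> ((('a \<Rightarrow> real) \<Rightarrow> real) \<Rightarrow> real)) topology" and C h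
    where Y: "locally_compact_space Y" and C: "closedin (Cp Y) C"
      and h: "homeomorphic_map (subtopology (beta X) A) (subtopology (Cp Y) C) h"
    using \<kappa> unfolding kappa_space_def homeomorphic_space by blast
  define r where "r = (\<lambda>y. \<lambda>x\<in>topspace X. h (beta_map X x) y)"
  have beta: "continuous_map X (subtopology (beta X) A) (beta_map X)"
    by (rule continuous_map_beta_map[OF A(1)])
  have hb: "continuous_map X (Cp Y) (h \<circ> beta_map X)"
    using continuous_map_compose[OF beta homeomorphic_imp_continuous_map[OF h]]
    by (simp add: continuous_map_in_subtopology)
  have r_cfun: "r y \<in> real_cfuns X" if "y \<in> topspace Y" for y
    using continuous_map_compose[OF hb continuous_map_Cp_component[OF that]]
    by (auto simp: real_cfuns_def r_def o_def intro: continuous_map_eq)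
  have r_cont: "continuous_map Y (Cp X) r"
    unfolding Cp_def[of X] continuous_map_in_subtopology continuous_map_componentwise
  proof (intro conjI ballI)
    show "r ` topspace Y \<subseteq> extensional (topspace X)" "r \<in> topspace Y \<rightarrow> real_cfuns X"
      using r_cfun by (auto simp: r_def)
    fix x assume x: "x \<in> topspace X"
    then have "h (beta_map X x) \<in> real_cfuns Y"
      using hb by (auto simp: continuous_map_def topspace_Cp Pi_iff)
    then show "continuous_map Y euclideanreal (\<lambda>y. r y x)"
      using x by (simp add: r_def real_cfuns_def)
  qed
  have "continuous_map (subtopology Y K) euclideanreal (\<lambda>y. dirac X z (r y))" if K: "compactin Y K" for K
  proof -
    have "continuous_map (subtopology Y K) (subtopology (Cp X) (r ` K)) r"
      using r_cont by (auto simp: continuous_map_in_subtopology continuous_map_from_subtopology)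
    moreover have "continuous_map (subtopology (Cp X) (r ` K)) euclideanreal (dirac X z)"
      using cont image_compactin[OF K r_cont] by (simp add: continuous_on_compacts_def)
    ultimately have "continuous_map (subtopology Y K) euclideanreal (dirac X z \<circ> r)"
      by (rule continuous_map_compose)
    then show ?thesis
      by (simp add: o_def)
  qed
  then have "continuous_map Y euclideanreal (\<lambda>y. dirac X z (r y))"
    by (rule continuous_map_if_continuous_on_compact_subspaces[OF Y])
  then have "(\<lambda>y\<in>topspace Y. dirac X z (r y)) \<in> real_cfuns Y"
    by (auto simp: real_cfuns_def intro: continuous_map_eq)
  also have "(\<lambda>y\<in>topspace Y. dirac X z (r y)) =
      (\<lambda>y\<in>topspace Y. restrict (dirac X z) (real_cfuns X) (r y))"
    using r_cfun by (auto simp: fun_eq_iff)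
  finally have "restrict (restrict (dirac X z) (real_cfuns X)) (unit_cfuns X) \<in> A"
    using C h unfolding r_def Cp_def[of Y]
    by (intro evaluation_limit_in_closed_subspace[OF dirac_evaluation_limit[OF z] A])
  moreover have "restrict (restrict (dirac X z) (real_cfuns X)) (unit_cfuns X) = z"
    using restrict_dirac_unit_cfuns[OF z] unit_cfuns_subset_real_cfuns[of X] by (simp add: inf_absorb2)
  ultimately show ?thesis by simp
qed

lemma continuous_on_compacts_beta_map:
  assumes "x \<in> topspace X"
  shows "continuous_on_compacts X (dirac X (beta_map X x))"
  unfolding continuous_on_compacts_def
proof (intro allI impI)
  fix K assume "compactin (Cp X) K"
  show "continuous_map (subtopology (Cp X) K) euclideanreal (dirac X (beta_map X x))"
    by (rule continuous_map_eq[OF continuous_map_from_subtopology[OF continuous_map_Cp_component[OF assms]]])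
      (simp add: topspace_Cp dirac_beta_map assms)
qed

text \<open>The embedding \<open>E\<close> sends \<open>z\<close> to the function that is \<open>\<delta>\<^sub>z\<close> on each summand of \<open>Y\<close>; the map \<open>\<Psi>\<close>
  recovers \<open>\<delta>\<^sub>z\<close> on all of \<open>C(X)\<close> from the one-point summands. A limit \<open>F\<close> of points \<open>E z\<close> gives a limit
  \<open>\<Psi> F\<close> of evaluations, thus \<open>\<Psi> F = \<delta>\<^sub>z\<close> for some \<open>z \<in> \<upsilon>X\<close>; continuity of \<open>F\<close> on the summands is
  the continuity of \<open>\<delta>\<^sub>z\<close> on compact sets.\<close>

lemma kappa_space_continuous_on_compacts:
  fixes X :: "'a topology"
  defines "A \<equiv> {z \<in> topspace (upsilon X). continuous_on_compacts X (dirac X z)}"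
  shows "kappa_space (subtopology (beta X) A)"
proof -
  define I where "I = {K. compactin (Cp X) K}"
  define Y where "Y = sum_topology (\<lambda>K. subtopology (Cp X) K) I"
  define P where "P = powertop_real (real_cfuns X)"
  define E where "E z = (\<lambda>p\<in>topspace Y. dirac X z (snd p))" for z
  define \<Psi> where "\<Psi> F = (\<lambda>f\<in>real_cfuns X. F ({f}, f))" for F :: "('a \<Rightarrow> real) set \<times> ('a \<Rightarrow> real) \<Rightarrow> real"
  have IC: "f \<in> real_cfuns X" if "K \<in> I" "f \<in> K" for K f
    using that compactin_Cp_subset by (auto simp: I_def)
  have topY: "topspace Y = Sigma I (\<lambda>K. K)"
    by (auto simp: Y_def topspace_Cp intro: IC)
  have single: "{f} \<in> I" if "f \<in> real_cfuns X" for f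
    using that by (simp add: I_def topspace_Cp)
  have HC: "Hausdorff_space (Cp X)"
    using tychonoff_space_powertop[of "topspace X"]
    by (simp add: Cp_def tychonoff_space_def Hausdorff_space_subtopology)
  have Y: "locally_compact_space Y" "Hausdorff_space Y"
    unfolding Y_def locally_compact_space_sum_topology
    by (auto simp: I_def compact_imp_locally_compact_space compact_space_subtopology
        intro: Hausdorff_space_sum_topology Hausdorff_space_subtopology HC)
  have A: "z \<in> topspace (upsilon X)" "continuous_on_compacts X (dirac X z)" if "z \<in> A" for z
    using that by (auto simp: A_def)
  have Aups: "subtopology (beta X) A = subtopology (upsilon X) A"
    using A by (auto simp: upsilon_def subtopology_subtopology topspace_upsilon inf_absorb2 subset_iff)
  have topA: "topspace (subtopology (beta X) A) = A"
    unfolding Aups using A by auto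
  have E_cfun: "E z \<in> real_cfuns Y" if z: "z \<in> A" for z
  proof -
    have "continuous_map Y euclideanreal (\<lambda>p. dirac X z (snd p))"
      unfolding Y_def using A[OF z]
      by (intro continuous_map_from_sum_topology) (simp add: o_def I_def continuous_on_compacts_def)
    then show ?thesis
      by (auto simp: real_cfuns_def E_def intro: continuous_map_eq)
  qed
  have E_cont: "continuous_map (subtopology (beta X) A) (Cp Y) E"
    unfolding Cp_def[of Y] continuous_map_in_subtopology continuous_map_componentwise
  proof (intro conjI ballI)
    show "E ` topspace (subtopology (beta X) A) \<subseteq> extensional (topspace Y)"
      by (auto simp: E_def)
    show "E \<in> topspace (subtopology (beta X) A) \<rightarrow> real_cfuns Y"
      using E_cfun topA by auto
    fix p assume "p \<in> topspace Y"
    then show "continuous_map (subtopology (beta X) A) euclideanreal (\<lambda>z. E z p)"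
      unfolding Aups E_def
      by (auto simp: topY intro!: continuous_map_from_subtopology continuous_map_dirac intro: IC)
  qed
  have \<Psi>_cont: "continuous_map (Cp Y) P \<Psi>"
    unfolding P_def continuous_map_componentwise
    using single by (auto simp: \<Psi>_def topY intro!: continuous_map_Cp_component)
  have \<Psi>E: "\<Psi> (E z) = restrict (dirac X z) (real_cfuns X)" for z
    using single by (auto simp: \<Psi>_def E_def topY fun_eq_iff)
  have \<Psi>E_unit: "restrict (\<Psi> (E z)) (unit_cfuns X) = z" if "z \<in> A" for z
    using restrict_dirac_unit_cfuns[OF A(1)[OF that]] unit_cfuns_subset_real_cfuns[of X]
    by (simp add: \<Psi>E inf_absorb2)
  have closed: "closedin (Cp Y) (E ` A)"
  proof -
    have "F \<in> E ` A" if F: "F \<in> Cp Y closure_of (E ` A)" for F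
    proof -
      have F_cfun: "F \<in> real_cfuns Y"
        using F closure_of_subset_topspace topspace_Cp by fastforce
      have "\<Psi> F \<in> P closure_of (\<Psi> ` E ` A)"
        using continuous_map_image_closure_subset[OF \<Psi>_cont] F by blast
      also have "\<dots> \<subseteq> P closure_of (evaluation_limits X)"
        using A(1) dirac_evaluation_limit[of _ X] by (intro closure_of_mono) (auto simp: \<Psi>E)
      also have "\<dots> = evaluation_limits X"
        by (simp add: P_def evaluation_limits_def)
      finally have \<Psi>F: "\<Psi> F \<in> evaluation_limits X" .
      define z where "z = restrict (\<Psi> F) (unit_cfuns X)"
      have z: "z \<in> topspace (upsilon X)"
        unfolding z_def by (rule restrict_evaluation_limit_in_upsilon[OF \<Psi>F])
      have eq: "restrict (dirac X z) (real_cfuns X) = \<Psi> F"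
      proof (rule evaluation_limits_eqI[OF dirac_evaluation_limit[OF z] \<Psi>F])
        fix u assume u: "u \<in> unit_cfuns X"
        then have "restrict (dirac X z) (real_cfuns X) u = z u"
          using unit_cfuns_subset_real_cfuns dirac_unit_cfuns[OF u z] by auto
        also have "\<dots> = \<Psi> F u"
          using u by (simp add: z_def)
        finally show "restrict (dirac X z) (real_cfuns X) u = \<Psi> F u" .
      qed
      then have dz: "dirac X z f = F ({f}, f)" if "f \<in> real_cfuns X" for f
      proof -
        have "restrict (dirac X z) (real_cfuns X) f = \<Psi> F f"
          by (simp only: eq)
        then show ?thesis
          using that by (simp add: \<Psi>_def)
      qed
      \<comment> \<open>The values at the copies of \<open>f\<close> in different summands coincide for each \<open>E z\<close>, hence for \<open>F\<close>.\<close>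
      have indep: "F (K, f) = F ({f}, f)" if "K \<in> I" "f \<in> K" for K f
      proof (rule forall_in_closure_of_eq[OF F Hausdorff_space_euclidean])
        show "continuous_map (Cp Y) euclidean (\<lambda>F. F (K, f))"
          "continuous_map (Cp Y) euclidean (\<lambda>F. F ({f}, f))"
          using that single[OF IC[OF that]] by (auto simp: topY intro!: continuous_map_Cp_component)
        show "G (K, f) = G ({f}, f)" if "G \<in> E ` A" for G
          using that \<open>K \<in> I\<close> \<open>f \<in> K\<close> single[OF IC[OF \<open>K \<in> I\<close> \<open>f \<in> K\<close>]] by (auto simp: E_def topY)
      qed
      have Fd: "F (K, f) = dirac X z f" if "K \<in> I" "f \<in> K" for K f
        using indep[OF that] dz[OF IC[OF that]] by simp
      have "continuous_on_compacts X (dirac X z)"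
        unfolding continuous_on_compacts_def
      proof (intro allI impI)
        fix K assume "compactin (Cp X) K"
        then have K: "K \<in> I" by (simp add: I_def)
        have "continuous_map (subtopology (Cp X) K) Y (Pair K)"
          unfolding Y_def using K by (rule continuous_map_component_injection)
        moreover have "continuous_map Y euclideanreal F"
          using F_cfun by (simp add: real_cfuns_def)
        ultimately have "continuous_map (subtopology (Cp X) K) euclideanreal (F \<circ> Pair K)"
          by (rule continuous_map_compose)
        then show "continuous_map (subtopology (Cp X) K) euclideanreal (dirac X z)"
          by (rule continuous_map_eq) (simp add: Fd[OF K])
      qed
      then have "z \<in> A" using z by (simp add: A_def)
      moreover have "F = E z"
      proof (rule extensionalityI)
        show "F \<in> extensional (topspace Y)" using F_cfun by (simp add: real_cfuns_def)
      qed (auto simp: E_def topY Fd)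
      ultimately show ?thesis by blast
    qed
    moreover have "E ` A \<subseteq> topspace (Cp Y)"
      using E_cfun topspace_Cp by blast
    ultimately show ?thesis
      using closure_of_subset_eq by blast
  qed
  have "homeomorphic_maps (subtopology (beta X) A) (subtopology (Cp Y) (E ` A)) E
      (\<lambda>F. restrict (\<Psi> F) (unit_cfuns X))"
    unfolding homeomorphic_maps_def topA
  proof (intro conjI ballI)
    show "continuous_map (subtopology (beta X) A) (subtopology (Cp Y) (E ` A)) E"
      using E_cont topA by (auto simp: continuous_map_in_subtopology)
    show "restrict (\<Psi> (E z)) (unit_cfuns X) = z" if "z \<in> A" for z
      using that by (rule \<Psi>E_unit)
    show "E (restrict (\<Psi> F) (unit_cfuns X)) = F" if "F \<in> topspace (subtopology (Cp Y) (E ` A))" for F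
      using that \<Psi>E_unit by auto
    have "A \<subseteq> topspace (beta X)" using topA by auto
    moreover have "continuous_map (subtopology (Cp Y) (E ` A)) (unit_cube (unit_cfuns X))
        (\<lambda>F. restrict (\<Psi> F) (unit_cfuns X))"
      unfolding unit_cube_def continuous_map_componentwise
    proof (intro conjI ballI)
      fix u assume u: "u \<in> unit_cfuns X"
      then have uC: "u \<in> real_cfuns X" using unit_cfuns_subset_real_cfuns by blast
      have "continuous_map (Cp Y) euclideanreal (\<lambda>F. F ({u}, u))"
        using single[OF uC] by (intro continuous_map_Cp_component) (auto simp: topY)
      then have "continuous_map (subtopology (Cp Y) (E ` A)) euclideanreal
          (\<lambda>F. restrict (\<Psi> F) (unit_cfuns X) u)"
        using u uC by (simp add: \<Psi>_def continuous_map_from_subtopology)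
      moreover have "restrict (\<Psi> (E z)) (unit_cfuns X) u \<in> {0..1}" if "z \<in> A" for z
        using \<Psi>E_unit[OF that] continuous_map_beta_component[OF u] that \<open>A \<subseteq> topspace (beta X)\<close>
        by (simp add: continuous_map_in_subtopology Pi_iff subset_iff)
      ultimately show "continuous_map (subtopology (Cp Y) (E ` A)) (top_of_set {0..1})
          (\<lambda>F. restrict (\<Psi> F) (unit_cfuns X) u)"
        by (auto simp: continuous_map_in_subtopology)
    qed auto
    moreover have "(\<lambda>F. restrict (\<Psi> F) (unit_cfuns X)) ` topspace (subtopology (Cp Y) (E ` A)) \<subseteq> A"
      using \<Psi>E_unit by auto
    ultimately show "continuous_map (subtopology (Cp Y) (E ` A)) (subtopology (beta X) A)
        (\<lambda>F. restrict (\<Psi> F) (unit_cfuns X))"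
      unfolding beta_def
      by (auto simp: continuous_map_in_subtopology image_subset_iff)
  qed
  then show ?thesis
    by (intro kappa_spaceI[OF Y closed]) (auto simp: homeomorphic_space_def)
qed

theorem theorem1p2:
  fixes X :: "'a topology" and z :: "('a \<Rightarrow> real) \<Rightarrow> real"
  assumes "tychonoff_space X" and "z \<in> topspace (upsilon X)"
  shows "(\<forall>K. compactin (Cp X) K \<longrightarrow> bounded (dirac X z ` K)) \<and>
    (z \<in> kappa_set X \<longleftrightarrow>
      (\<forall>K. compactin (Cp X) K \<longrightarrow> continuous_map (subtopology (Cp X) K) euclideanreal (dirac X z)))"
proof (intro conjI)
  show "\<forall>K. compactin (Cp X) K \<longrightarrow> bounded (dirac X z ` K)"
    using bounded_dirac_image_compact[OF assms(2)] by blast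
  have "z \<in> kappa_set X \<longleftrightarrow> continuous_on_compacts X (dirac X z)"
  proof
    let ?A = "{z \<in> topspace (upsilon X). continuous_on_compacts X (dirac X z)}"
    have "beta_map X ` topspace X \<subseteq> ?A" "?A \<subseteq> topspace (beta X)"
      using beta_map_subset_upsilon[of X] upsilon_set_subset_beta[of X] continuous_on_compacts_beta_map[of _ X]
      by (auto simp: topspace_upsilon)
    then have "kappa_set X \<subseteq> ?A"
      using kappa_space_continuous_on_compacts[of X] unfolding kappa_set_def by blast
    then show "z \<in> kappa_set X \<Longrightarrow> continuous_on_compacts X (dirac X z)"
      by blast
    show "continuous_on_compacts X (dirac X z) \<Longrightarrow> z \<in> kappa_set X"
      using continuous_on_compacts_in_kappa_space[OF assms(2)] unfolding kappa_set_def by blast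
  qed
  then show "z \<in> kappa_set X \<longleftrightarrow>
      (\<forall>K. compactin (Cp X) K \<longrightarrow> continuous_map (subtopology (Cp X) K) euclideanreal (dirac X z))"
    by (simp add: continuous_on_compacts_def)
qed

end
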